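(* Let $W$ be a random variable having an atomless law on the interval $[0,1]$. Then the following are equivalent: (1) $W\sim 1-W$ and $W\sim\min\left\{\frac{W}{1-W},\frac{1-W}{W}\right\}$. (2) $W\sim\mu(p)$, with $p(n)=2^{-n}$ for $n=1,2,\dots$. (3) The distribution function of $W$ at irrational points is given by $$\Pr(W<[k_1,k_2,\dots])=2\sum_{n=1}^{\infty}(-1)^{n+1}2^{-\sum_{j=1}^n k_j}$$ for all $k_j\in\{1,2,\dots\}$, $j=1,2,\dots$.
   Context: $X\sim Y$ means that $X$ and $Y$ have the same law; $X\sim\alpha$ means that $X$ has law $\alpha$. For positive integers $k_1,k_2,\dots$, $[k_1,k_2,\dots]=\frac{1}{k_1+\frac{1}{k_2+\cdots}}$ is the infinite continued fraction (the limit of the finite continued fractions $\frac{1}{k_1+\frac{1}{\ddots+\frac{1}{k_n}}}$); it is an irrational number in $(0,1)$ and every irrational number in $(0,1)$ has a unique such expansion. For a probability distribution $p$ on the positive integers, $\mu(p)$ denotes the law on $[0,1]$ of $[K_1,K_2,\dots]$, where $K_1,K_2,\dots$ are i.i.d. with distribution $p$. (The function of $[k_1,k_2,\dots]$ on the right-hand side of (3) is the Minkowski question mark function.) *)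

theory Defs
  imports "HOL-Probability.Probability"
begin

text \<open>
  Partial quotients are indexed from 0: the sequence \<open>k\<close> stands for
  \<open>k\<^sub>1 = k 0\<close>, \<open>k\<^sub>2 = k 1\<close>, and so on.  The value of \<open>cfrac_conv k n\<close> is the
  finite continued fraction with the first \<open>n\<close> partial quotients; it is 0 for \<open>n = 0\<close>.
\<close>

fun cfrac_conv :: "(nat \<Rightarrow> nat) \<Rightarrow> nat \<Rightarrow> real" where
  "cfrac_conv k 0 = 0"
| "cfrac_conv k (Suc n) = 1 / (real (k 0) + cfrac_conv (\<lambda>i. k (Suc i)) n)"

definition cfrac :: "(nat \<Rightarrow> nat) \<Rightarrow> real" where
  "cfrac k = lim (cfrac_conv k)"

text \<open>
  The coordinates of the product space are i.i.d. with distribution \<open>p\<close>.  The definition is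
  meant for \<open>p\<close> supported on the positive integers.
\<close>

definition cfrac_law :: "nat pmf \<Rightarrow> real measure" where
  "cfrac_law p = distr (\<Pi>\<^sub>M i\<in>UNIV. measure_pmf p) borel cfrac"

definition halving_pmf :: "nat pmf" where
  "halving_pmf = map_pmf Suc (geometric_pmf (1/2))"

lemma pmf_halving_pmf: "pmf halving_pmf n = (if n = 0 then 0 else 1 / 2 ^ n)"
proof (cases n)
  case 0
  then show ?thesis
    by (auto simp: halving_pmf_def pmf_eq_0_set_pmf)
next
  case (Suc m)
  have "pmf halving_pmf (Suc m) = pmf (geometric_pmf (1/2)) m"
    unfolding halving_pmf_def by (rule pmf_map_inj') simp
  then show ?thesis
    using Suc by (simp add: power_one_over)
qed

lemma measurable_cfrac_conv:
  "(\<lambda>k. cfrac_conv k n) \<in> borel_measurable (\<Pi>\<^sub>M i\<in>UNIV. measure_pmf p)"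
proof (induction n)
  case (Suc n)
  have shift: "(\<lambda>k i. k (Suc i)) \<in>
      measurable (\<Pi>\<^sub>M i\<in>UNIV. measure_pmf p) (\<Pi>\<^sub>M i\<in>UNIV. measure_pmf p)"
    by (rule measurable_PiM_single') (auto intro: measurable_component_singleton)
  have "(\<lambda>k. k 0) \<in> measurable (\<Pi>\<^sub>M i\<in>(UNIV::nat set). measure_pmf p) (measure_pmf p)"
    by (rule measurable_component_singleton) simp
  then have "(\<lambda>k. real (k 0)) \<in> borel_measurable (\<Pi>\<^sub>M i\<in>(UNIV::nat set). measure_pmf p)"
    by (rule measurable_compose) simp
  with measurable_compose[OF shift Suc.IH] show ?case
    by simp
qed simp

lemma measurable_cfrac: "cfrac \<in> borel_measurable (\<Pi>\<^sub>M i\<in>UNIV. measure_pmf p)"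
  unfolding cfrac_def[abs_def]
  by (rule borel_measurable_lim_metric) (rule measurable_cfrac_conv)

end

theory Submission
  imports Defs
begin

text \<open>
  Write \<open>F\<close> for the distribution function of \<open>W\<close> and \<open>k'\<close> for the sequence
  \<open>k\<close> without its first term.  All three conditions amount to the single recursion
  \<open>F([k]) = (2 - F([k'])) / 2^{k\<^sub>1}\<close>
  over all sequences \<open>k\<close> of positive integers.

  The recursion halves at least the difference of two solutions in each step, so it has only one
  bounded solution, and the alternating series in (3) solves it
  (\<open>question_mark_series_rec\<close>, \<open>question_mark_series_unique\<close>).  Hence the recursion is
  equivalent to (3).

  For the law \<open>\<mu>(p)\<close> the recursion is a decomposition by the first partial quotient: in
  \<open>1/(K\<^sub>1 + Y) < 1/(k\<^sub>1 + x)\<close> either \<open>K\<^sub>1 > k\<^sub>1\<close>, which has probability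
  \<open>2^{-k\<^sub>1}\<close>, or \<open>K\<^sub>1 = k\<^sub>1\<close>, again of probability \<open>2^{-k\<^sub>1}\<close>, and \<open>Y > x\<close>,
  where \<open>Y\<close> is independent of \<open>K\<^sub>1\<close> and has the same law \<open>\<mu>(p)\<close>
  (\<open>cdf_cfrac_law\<close>).  Continued fractions are dense in the unit interval, so a law on it is
  determined by its distribution function there (\<open>real_distribution_eqI_cfrac\<close>).  Thus (2) and
  (3) are equivalent.

  In terms of \<open>F\<close>, the two invariances in (1) read \<open>F(1 - x) = 1 - F(x)\<close> and
  \<open>F(x) = F(x/(1+x)) + 1 - F(1/(1+x))\<close>.  Together they say that
  \<open>F(x/(1+x)) = F(x)/2\<close> and \<open>F(1/(1+x)) = 1 - F(x)/2\<close>.  The second map prepends the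
  partial quotient 1 and the first one increases the leading partial quotient by 1, so iterating
  them produces the recursion (\<open>cdf_cfrac_if_invariant\<close>).  Conversely, the recursion gives the
  two identities, hence the invariances, at every continued fraction, and density extends them to
  the laws (\<open>invariant_if_cdf_cfrac\<close>).
\<close>


section \<open>Convergence of continued fractions\<close>

text \<open>
  The step in the convergence proof.  The denominators \<open>a + s\<close> and \<open>a + t\<close> are at least
  \<open>1\<close> and \<open>1 + d\<close> for \<open>d = \<bar>s - t\<bar>\<close>, so a gap \<open>d\<close> becomes at most
  \<open>d/(1 + d)\<close>.  This function maps \<open>1/(n+1)\<close> to \<open>1/(n+2)\<close>; the single map has
  no contraction factor below 1 on the unit interval, and the harmonic rate replaces it.
\<close>

lemma abs_inverse_add_diff_le:
  fixes a s t :: real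
  assumes "1 \<le> a" "0 \<le> s" "0 \<le> t" "\<bar>s - t\<bar> \<le> 1 / (real n + 1)"
  shows "\<bar>1 / (a + s) - 1 / (a + t)\<bar> \<le> 1 / (real (Suc n) + 1)"
  using assms(2-4)
proof (induction s t rule: linorder_wlog)
  case (le s t)
  define d where "d = t - s"
  have d: "0 \<le> d" "d * (real n + 1) \<le> 1"
    using le by (auto simp: d_def field_simps)
  have pos: "0 < a + s" "0 < a + t" using le assms(1) by auto
  have "1 / (a + s) - 1 / (a + t) = d / ((a + s) * (a + t))"
    using pos by (simp add: d_def field_simps)
  then have "\<bar>1 / (a + s) - 1 / (a + t)\<bar> = d / ((a + s) * (a + t))"
    using pos d(1) by simp
  also have "\<dots> \<le> d / (1 * (1 + d))"
    using assms(1) le d by (intro divide_left_mono mult_mono mult_pos_pos) (auto simp: d_def)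
  also have "\<dots> \<le> 1 / (real (Suc n) + 1)"
    using d by (simp add: field_simps)
  finally show ?case .
next
  case (sym s t)
  then show ?case by (simp add: abs_minus_commute)
qed

lemma cfrac_conv_nonneg: "0 \<le> cfrac_conv k n"
  by (induction k n rule: cfrac_conv.induct) auto

text \<open>
  Two truncations that share \<open>N\<close> partial quotients arise from two points of the unit interval
  by the same \<open>N\<close> steps.
\<close>

lemma abs_cfrac_conv_diff_le:
  assumes "\<forall>j. k j \<ge> 1" "N \<le> m" "N \<le> n"
  shows "\<bar>cfrac_conv k m - cfrac_conv k n\<bar> \<le> 1 / (real N + 1)"
  using assms
proof (induction N arbitrary: k m n)
  case 0
  have "cfrac_conv k i \<le> 1" for i
    using spec[OF 0(1), of 0] cfrac_conv_nonneg[of "\<lambda>i. k (Suc i)"]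
    by (cases i) (auto simp: divide_le_eq_1 intro: add_increasing2)
  from this[of m] this[of n] show ?case
    using cfrac_conv_nonneg[of k m] cfrac_conv_nonneg[of k n] by (simp add: abs_if)
next
  case (Suc N)
  obtain m' n' where mn: "m = Suc m'" "n = Suc n'" "N \<le> m'" "N \<le> n'"
    using Suc.prems by (metis Suc_le_D Suc_le_mono)
  have "\<bar>cfrac_conv (\<lambda>i. k (Suc i)) m' - cfrac_conv (\<lambda>i. k (Suc i)) n'\<bar> \<le> 1 / (real N + 1)"
    using Suc mn by auto
  moreover have "1 \<le> real (k 0)"
    using Suc.prems(1) by simp
  ultimately show ?case
    unfolding mn(1,2) cfrac_conv.simps by (intro abs_inverse_add_diff_le cfrac_conv_nonneg)
qed

lemma cfrac_conv_tendsto_cfrac: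
  assumes "\<forall>j. k j \<ge> 1"
  shows "cfrac_conv k \<longlonglongrightarrow> cfrac k"
proof -
  have "Cauchy (cfrac_conv k)"
  proof (rule metric_CauchyI)
    fix e :: real assume "0 < e"
    then obtain N where N: "1 / (real N + 1) < e"
      using reals_Archimedean[of e] by (auto simp: inverse_eq_divide add.commute)
    have "dist (cfrac_conv k m) (cfrac_conv k n) < e" if "m \<ge> N" "n \<ge> N" for m n
      using abs_cfrac_conv_diff_le[OF assms that] N unfolding dist_real_def by linarith
    then show "\<exists>M. \<forall>m\<ge>M. \<forall>n\<ge>M. dist (cfrac_conv k m) (cfrac_conv k n) < e"
      by blast
  qed
  then show ?thesis
    unfolding cfrac_def by (simp add: Cauchy_convergent_iff convergent_LIMSEQ_iff)
qed

lemma cfrac_nonneg: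
  assumes "\<forall>j. k j \<ge> 1"
  shows "0 \<le> cfrac k"
  using cfrac_conv_tendsto_cfrac[OF assms]
  by (rule LIMSEQ_le_const) (auto simp: cfrac_conv_nonneg)

lemma cfrac_rec:
  assumes "\<forall>j. k j \<ge> 1"
  shows "cfrac k = 1 / (real (k 0) + cfrac (\<lambda>i. k (Suc i)))"
proof (rule LIMSEQ_unique)
  show "(\<lambda>n. cfrac_conv k (Suc n)) \<longlonglongrightarrow> cfrac k"
    using cfrac_conv_tendsto_cfrac[OF assms] by (rule LIMSEQ_Suc)
  have "1 \<le> real (k 0)" "0 \<le> cfrac (\<lambda>i. k (Suc i))"
    using assms by (simp_all add: cfrac_nonneg)
  then have "real (k 0) + cfrac (\<lambda>i. k (Suc i)) \<noteq> 0" by linarith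
  then show "(\<lambda>n. cfrac_conv k (Suc n)) \<longlonglongrightarrow> 1 / (real (k 0) + cfrac (\<lambda>i. k (Suc i)))"
    unfolding cfrac_conv.simps
    using assms by (intro tendsto_intros cfrac_conv_tendsto_cfrac) simp
qed

lemma cfrac_in_unit_interval:
  assumes "\<forall>j. k j \<ge> 1"
  shows "cfrac k \<in> {0<..<1}"
proof -
  have pos: "0 < cfrac k" if "\<forall>j. k j \<ge> 1" for k
  proof -
    have "1 \<le> real (k 0)" "0 \<le> cfrac (\<lambda>i. k (Suc i))"
      using that by (simp_all add: cfrac_nonneg)
    then show ?thesis unfolding cfrac_rec[OF that] by simp
  qed
  have "1 \<le> real (k 0)" "0 < cfrac (\<lambda>i. k (Suc i))"
    using assms by (simp_all add: pos)
  then have "cfrac k < 1" unfolding cfrac_rec[OF assms] by simp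
  with pos[OF assms] show ?thesis by simp
qed

section \<open>Density of continued fractions\<close>

text \<open>
  The digits read off by the Gauss map, which sends \<open>x\<close> to the fractional part of \<open>1/x\<close>.
\<close>

fun gauss_digit :: "real \<Rightarrow> nat \<Rightarrow> nat" where
  "gauss_digit x 0 = nat \<lfloor>1 / x\<rfloor>"
| "gauss_digit x (Suc n) = gauss_digit (frac (1 / x)) n"

lemma gauss_map_irrational:
  assumes "x \<in> {0<..<1}" "x \<notin> \<rat>"
  shows "frac (1 / x) \<in> {0<..<1}" "frac (1 / x) \<notin> \<rat>"
    and "x = 1 / (real (gauss_digit x 0) + frac (1 / x))"
    and "gauss_digit x 0 \<ge> 1"
proof -
  have irr: "1 / x \<notin> \<rat>"
    using assms(2) by (metis Rats_1 Rats_divide div_by_1 divide_divide_eq_right mult_1)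
  then show nr: "frac (1 / x) \<notin> \<rat>"
    unfolding frac_def by (metis Rats_add Rats_of_int diff_add_cancel)
  then have "frac (1 / x) \<noteq> 0" by (metis Rats_0)
  then show "frac (1 / x) \<in> {0<..<1}"
    using frac_ge_0[of "1 / x"] frac_lt_1[of "1 / x"] by auto
  have "1 \<le> \<lfloor>1 / x\<rfloor>" using assms(1) by (simp add: field_simps)
  then show "gauss_digit x 0 \<ge> 1" by (simp add: le_nat_iff del: one_le_floor)
  show "x = 1 / (real (gauss_digit x 0) + frac (1 / x))"
    using assms(1) by (simp add: frac_def of_nat_nat)
qed

lemma gauss_digit_pos:
  assumes "x \<in> {0<..<1}" "x \<notin> \<rat>"
  shows "gauss_digit x n \<ge> 1"
  using assms
proof (induction n arbitrary: x)
  case 0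
  then show ?case by (rule gauss_map_irrational)
next
  case (Suc n)
  then show ?case using gauss_map_irrational(1,2)[of x] by simp
qed

lemma abs_diff_cfrac_conv_gauss_digit_le:
  assumes "x \<in> {0<..<1}" "x \<notin> \<rat>"
  shows "\<bar>x - cfrac_conv (gauss_digit x) n\<bar> \<le> 1 / (real n + 1)"
  using assms
proof (induction n arbitrary: x)
  case (Suc n)
  note g = gauss_map_irrational[OF Suc.prems]
  have "\<bar>1 / (real (gauss_digit x 0) + frac (1 / x)) -
         1 / (real (gauss_digit x 0) + cfrac_conv (gauss_digit (frac (1 / x))) n)\<bar>
        \<le> 1 / (real (Suc n) + 1)"
    using g Suc.IH[OF g(1,2)] by (intro abs_inverse_add_diff_le) (auto simp: cfrac_conv_nonneg)
  then show ?case
    using g(3) by (simp del: gauss_digit.simps(1))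
qed auto

lemma irrational_eq_cfrac:
  assumes "x \<in> {0<..<1}" "x \<notin> \<rat>"
  shows "x = cfrac (gauss_digit x)"
proof -
  have "(\<lambda>n. x - cfrac_conv (gauss_digit x) n) \<longlonglongrightarrow> 0"
    by (rule Lim_null_comparison[OF _ LIMSEQ_inverse_real_of_nat])
       (use abs_diff_cfrac_conv_gauss_digit_le[OF assms] in
         \<open>auto simp: inverse_eq_divide add.commute\<close>)
  moreover have "(\<lambda>n. x - cfrac_conv (gauss_digit x) n) \<longlonglongrightarrow> x - cfrac (gauss_digit x)"
    by (intro tendsto_intros cfrac_conv_tendsto_cfrac allI gauss_digit_pos assms)
  ultimately show ?thesis
    using LIMSEQ_unique by force
qed

lemma cfrac_dense:
  fixes a b :: real
  assumes "0 \<le> a" "a < b" "b \<le> 1"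
  obtains k where "\<forall>j. k j \<ge> 1" "a < cfrac k" "cfrac k < b"
proof -
  \<comment> \<open>An irrational point of the interval exists by cardinality.\<close>
  have "\<not> {a<..<b} \<subseteq> \<rat>"
    using countable_subset[OF _ countable_rat] uncountable_open_interval[of a b] assms(2) by blast
  then obtain x where x: "x \<in> {a<..<b}" "x \<notin> \<rat>" by blast
  with assms have "x \<in> {0<..<1}" by auto
  with x that[of "gauss_digit x"] gauss_digit_pos irrational_eq_cfrac show ?thesis
    by (metis greaterThanLessThan_iff)
qed

text \<open>
  Distribution functions are right-continuous, so agreement on a set that is dense in the unit
  interval suffices.  The conditions at 0 and 1 confine both laws to \<open>(0,1]\<close>.
\<close>

lemma real_distribution_eqI_cfrac:
  assumes "real_distribution M" "real_distribution N"
    and M: "cdf M 0 = 0" "cdf M 1 = 1" and N: "cdf N 0 = 0" "cdf N 1 = 1"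
    and eq: "\<And>k. (\<forall>j. k j \<ge> 1) \<Longrightarrow> cdf M (cfrac k) = cdf N (cfrac k)"
  shows "M = N"
proof (rule cdf_unique[OF assms(1,2)], rule ext)
  interpret M: real_distribution M by fact
  interpret N: real_distribution N by fact
  fix x :: real
  consider "x \<le> 0" | "0 < x" "x < 1" | "1 \<le> x" by linarith
  then show "cdf M x = cdf N x"
  proof cases
    case 1
    then have "cdf M x = 0" "cdf N x = 0"
      using M N M.cdf_nondecreasing[of x 0] N.cdf_nondecreasing[of x 0]
        M.cdf_nonneg[of x] N.cdf_nonneg[of x] by linarith+
    then show ?thesis by simp
  next
    case 3
    then have "cdf M x = 1" "cdf N x = 1"
      using M N M.cdf_nondecreasing[of 1 x] N.cdf_nondecreasing[of 1 x]
        M.cdf_bounded_prob[of x] N.cdf_bounded_prob[of x] by linarith+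
    then show ?thesis by simp
  next
    case 2
    have "\<exists>k. (\<forall>j. k j \<ge> 1) \<and> x < cfrac k \<and> cfrac k < min 1 (x + inverse (real (Suc n)))" for n
    proof -
      have "x < min 1 (x + inverse (real (Suc n)))" using 2 by simp
      then obtain k where "\<forall>j. k j \<ge> 1" "x < cfrac k"
          "cfrac k < min 1 (x + inverse (real (Suc n)))"
        using cfrac_dense[of x "min 1 (x + inverse (real (Suc n)))"] 2(1)
        by (metis less_imp_le min.cobounded1)
      then show ?thesis by blast
    qed
    then obtain k where k: "\<And>n. \<forall>j. k n j \<ge> 1" "\<And>n. x < cfrac (k n)"
        "\<And>n. cfrac (k n) < min 1 (x + inverse (real (Suc n)))"
      by metis
    have "(\<lambda>n. cfrac (k n)) \<longlonglongrightarrow> x"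
    proof (rule tendsto_sandwich[of "\<lambda>_. x" _ _ "\<lambda>n. x + inverse (real (Suc n))"])
      show "(\<lambda>n. x + inverse (real (Suc n))) \<longlonglongrightarrow> x"
        by (rule LIMSEQ_inverse_real_of_nat_add)
      show "(\<lambda>_. x) \<longlonglongrightarrow> x" by simp
    qed (use less_imp_le[OF k(2)] less_imp_le[OF k(3)] in \<open>auto intro!: always_eventually\<close>)
    then have *: "filterlim (\<lambda>n. cfrac (k n)) (at_right x) sequentially"
      using k(2) by (auto simp: filterlim_at intro!: always_eventually dest: less_imp_neq[symmetric])
    have "(\<lambda>n. cdf M (cfrac (k n))) \<longlonglongrightarrow> cdf M x" "(\<lambda>n. cdf N (cfrac (k n))) \<longlonglongrightarrow> cdf N x"
      using M.cdf_is_right_cont[of x] N.cdf_is_right_cont[of x] unfolding continuous_within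
      by (auto intro: filterlim_compose[OF _ *])
    then show ?thesis
      using eq k(1) LIMSEQ_unique by simp
  qed
qed

section \<open>The alternating dyadic series\<close>

definition question_mark_series :: "(nat \<Rightarrow> nat) \<Rightarrow> real" where
  "question_mark_series k = 2 * (\<Sum>n. (- 1) ^ n / 2 ^ (\<Sum>j\<le>n. k j))"

lemma abs_question_mark_term_le:
  assumes "\<forall>j. k j \<ge> (1::nat)"
  shows "\<bar>(- 1) ^ n / 2 ^ (\<Sum>j\<le>n. k j)\<bar> \<le> (1 / 2 :: real) ^ Suc n"
proof -
  have "Suc n \<le> (\<Sum>j\<le>n. k j)"
    using sum_mono[of "{..n}" "\<lambda>_. 1" k] assms by simp
  then have "(2::real) ^ Suc n \<le> 2 ^ (\<Sum>j\<le>n. k j)"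
    by (intro power_increasing) auto
  then show ?thesis
    by (simp add: power_one_over power_abs abs_mult field_simps)
qed

lemma summable_question_mark_term:
  assumes "\<forall>j. k j \<ge> (1::nat)"
  shows "summable (\<lambda>n. (- 1) ^ n / 2 ^ (\<Sum>j\<le>n. k j) :: real)"
proof (rule summable_comparison_test')
  show "summable (\<lambda>n. (1 / 2) ^ Suc n :: real)"
    by (subst summable_Suc_iff) (simp add: summable_geometric)
  show "norm ((- 1) ^ n / 2 ^ (\<Sum>j\<le>n. k j) :: real) \<le> (1 / 2) ^ Suc n" for n
    unfolding real_norm_def by (rule abs_question_mark_term_le[OF assms])
qed

lemma abs_question_mark_series_le:
  assumes "\<forall>j. k j \<ge> 1"
  shows "\<bar>question_mark_series k\<bar> \<le> 2"
proof -
  have "norm (\<Sum>n. (- 1) ^ n / 2 ^ (\<Sum>j\<le>n. k j) :: real) \<le> (\<Sum>n. (1 / 2) ^ Suc n :: real)"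
  proof (rule norm_suminf_le)
    show "norm ((- 1) ^ n / 2 ^ (\<Sum>j\<le>n. k j) :: real) \<le> (1 / 2) ^ Suc n" for n
      unfolding real_norm_def by (rule abs_question_mark_term_le[OF assms])
  qed (use power_half_series in \<open>simp add: sums_iff\<close>)
  also have "\<dots> = 1"
    using power_half_series by (simp add: sums_iff)
  finally show ?thesis
    by (simp add: question_mark_series_def abs_mult)
qed

lemma question_mark_series_rec:
  assumes "\<forall>j. k j \<ge> 1"
  shows "question_mark_series k = (2 - question_mark_series (\<lambda>i. k (Suc i))) / 2 ^ k 0"
proof -
  let ?a = "\<lambda>k n. (- 1) ^ n / 2 ^ (\<Sum>j\<le>n. k j) :: real"
  have "?a k (Suc n) = - ?a (\<lambda>i. k (Suc i)) n / 2 ^ k 0" for n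
    by (simp add: sum.atMost_Suc_shift power_add del: sum.atMost_Suc)
  then have "(\<Sum>n. ?a k (Suc n)) = - (\<Sum>n. ?a (\<lambda>i. k (Suc i)) n) / 2 ^ k 0"
    using assms summable_question_mark_term[of "\<lambda>i. k (Suc i)"]
    by (simp add: suminf_divide[symmetric] suminf_minus[symmetric] summable_minus summable_divide)
  moreover have "(\<Sum>n. ?a k n) = (\<Sum>n. ?a k (Suc n)) + ?a k 0"
    using suminf_split_head[OF summable_question_mark_term[OF assms]] by simp
  ultimately show ?thesis
    by (simp add: question_mark_series_def field_simps)
qed

text \<open>
  In each step of the recursion the difference of two solutions is divided by
  \<open>2 ^ k 0\<close>, hence by at least 2; iterating makes it vanish.
\<close>

lemma question_mark_series_unique:
  fixes F :: "(nat \<Rightarrow> nat) \<Rightarrow> real"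
  assumes bound: "\<And>k. (\<forall>j. k j \<ge> 1) \<Longrightarrow> \<bar>F k\<bar> \<le> C"
    and rec: "\<And>k. (\<forall>j. k j \<ge> 1) \<Longrightarrow> F k = (2 - F (\<lambda>i. k (Suc i))) / 2 ^ k 0"
    and k: "\<forall>j. k j \<ge> 1"
  shows "F k = question_mark_series k"
proof -
  have *: "\<bar>F k - question_mark_series k\<bar> \<le> (C + 2) * (1 / 2) ^ n" if "\<forall>j. k j \<ge> 1" for n k
    using that
  proof (induction n arbitrary: k)
    case 0
    from bound[OF this] abs_question_mark_series_le[OF this] show ?case by (simp add: abs_le_iff)
  next
    case (Suc n)
    let ?k' = "\<lambda>i. k (Suc i)"
    have "\<bar>F k - question_mark_series k\<bar> = \<bar>F ?k' - question_mark_series ?k'\<bar> / 2 ^ k 0"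
      using rec[OF Suc.prems] question_mark_series_rec[OF Suc.prems]
      by (simp add: diff_divide_distrib[symmetric] abs_minus_commute)
    also have "\<dots> \<le> \<bar>F ?k' - question_mark_series ?k'\<bar> / 2 ^ 1"
      using Suc.prems by (intro divide_left_mono power_increasing) auto
    also have "\<dots> \<le> (C + 2) * (1 / 2) ^ n / 2 ^ 1"
      using Suc by (intro divide_right_mono) auto
    finally show ?case by simp
  qed
  have "(\<lambda>n. (C + 2) * (1 / 2) ^ n) \<longlonglongrightarrow> (C + 2) * 0"
    by (intro tendsto_intros LIMSEQ_realpow_zero) auto
  then have "\<bar>F k - question_mark_series k\<bar> \<le> (C + 2) * 0"
    by (rule LIMSEQ_le_const) (use *[OF k] in auto)
  then show ?thesis by simp
qed

section \<open>Invariance of atomless laws on the unit interval\<close>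

text \<open>
  The map in the second invariance is the Farey map.  Its two inverse branches are
  \<open>x/(1+x)\<close> and \<open>1/(1+x)\<close>.
\<close>

definition farey_map :: "real \<Rightarrow> real" where
  "farey_map w = min (w / (1 - w)) ((1 - w) / w)"

lemma borel_measurable_farey_map [measurable]: "farey_map \<in> borel_measurable borel"
  unfolding farey_map_def[abs_def] by measurable

lemma farey_map_le_iff:
  assumes "w \<in> {0<..<1}" "0 < x"
  shows "farey_map w \<le> x \<longleftrightarrow> w \<le> x / (1 + x) \<or> 1 / (1 + x) \<le> w"
proof -
  have "w / (1 - w) \<le> x \<longleftrightarrow> w \<le> x / (1 + x)" "(1 - w) / w \<le> x \<longleftrightarrow> 1 / (1 + x) \<le> w"
    using assms by (auto simp: field_simps)
  then show ?thesis
    by (auto simp: farey_map_def min_le_iff_disj)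
qed

locale atomless_unit_law = real_distribution N for N :: "real measure" +
  assumes AE_unit: "AE x in N. x \<in> {0..1}"
    and no_atom: "\<And>x. measure N {x} = 0"
begin

lemma AE_neq: "AE y in N. y \<noteq> x"
  using prob_eq_0[of "{x}"] no_atom[of x] by simp

lemma AE_open_unit: "AE x in N. x \<in> {0<..<1}"
  using AE_unit AE_neq[of 0] AE_neq[of 1] by eventually_elim auto

lemma cdf_0: "cdf N 0 = 0"
proof -
  have "prob {..0} = 0"
    using AE_open_unit by (subst prob_eq_0) (auto elim!: eventually_mono)
  then show ?thesis by (simp add: cdf_def)
qed

lemma cdf_1: "cdf N 1 = 1"
proof -
  have "prob {..1} = 1"
    using AE_open_unit by (subst prob_eq_1) (auto elim: eventually_mono)
  then show ?thesis by (simp add: cdf_def)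
qed

lemma prob_lessThan: "prob {..<x} = cdf N x"
  unfolding cdf_def using AE_neq[of x] by (intro measure_eq_AE) (auto elim!: eventually_mono)

lemma prob_atLeast: "prob {x..} = 1 - cdf N x"
proof -
  have "prob {x..} = prob (space N - {..<x})"
    by (rule arg_cong[where f = prob]) auto
  also have "\<dots> = 1 - cdf N x"
    by (subst prob_compl) (auto simp: prob_lessThan)
  finally show ?thesis .
qed

lemma real_distribution_image:
  assumes "f \<in> borel_measurable borel"
  shows "real_distribution (distr N borel f)"
  using assms by (intro real_distribution.intro prob_space_distr real_distribution_axioms.intro) auto

lemma cdf_image:
  assumes "f \<in> borel_measurable borel" "A \<in> sets borel"
    and "\<And>w. w \<in> {0<..<1} \<Longrightarrow> f w \<le> x \<longleftrightarrow> w \<in> A"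
  shows "cdf (distr N borel f) x = prob A"
proof -
  have "cdf (distr N borel f) x = prob (f -` {..x} \<inter> space N)"
    using assms(1) unfolding cdf_def by (intro measure_distr) auto
  also have "\<dots> = prob A"
  proof (rule measure_eq_AE)
    show "AE w in N. w \<in> f -` {..x} \<inter> space N \<longleftrightarrow> w \<in> A"
      using AE_open_unit by eventually_elim (use assms(3) in auto)
    show "f -` {..x} \<inter> space N \<in> sets N"
      by (rule measurable_sets[OF measurable_finite_borel[OF assms(1)]]) auto
  qed (use assms(2) in auto)
  finally show ?thesis .
qed

lemma cdf_reflection: "cdf (distr N borel (\<lambda>w. 1 - w)) x = 1 - cdf N (1 - x)"
proof -
  have "cdf (distr N borel (\<lambda>w. 1 - w)) x = prob {1 - x..}"
    by (rule cdf_image) auto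
  then show ?thesis by (simp add: prob_atLeast)
qed

text \<open>
  The preimage of \<open>{..x}\<close> under the Farey map consists of one interval at each end of the unit
  interval, one for each inverse branch.
\<close>

lemma cdf_farey_map:
  assumes "0 < x" "x < 1"
  shows "cdf (distr N borel farey_map) x = cdf N (x / (1 + x)) + 1 - cdf N (1 / (1 + x))"
proof -
  have "cdf (distr N borel farey_map) x = prob ({..x / (1 + x)} \<union> {1 / (1 + x)..})"
    using assms by (intro cdf_image) (auto simp: farey_map_le_iff)
  also have "\<dots> = prob {..x / (1 + x)} + prob {1 / (1 + x)..}"
    using assms by (intro finite_measure_Union) (auto simp: field_simps)
  finally show ?thesis
    by (simp add: prob_atLeast cdf_def)
qed

lemma cdf_farey_map_0: "cdf (distr N borel farey_map) 0 = 0"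
  using cdf_image[of farey_map "{}" 0]
  by (auto simp: farey_map_def min_le_iff_disj divide_le_0_iff)

lemma cdf_farey_map_1: "cdf (distr N borel farey_map) 1 = 1"
proof -
  have "cdf (distr N borel farey_map) 1 = prob UNIV"
    by (intro cdf_image) (auto simp: farey_map_le_iff)
  then show ?thesis using prob_space by simp
qed

text \<open>
  The two invariances give the value of the distribution function at the image of a point under
  either inverse branch of the Farey map.  One application of \<open>1/(1+y)\<close> followed by
  \<open>k - 1\<close> applications of \<open>y/(1+y)\<close> leads from \<open>x\<close> to \<open>1/(k+x)\<close>.
\<close>

lemma cdf_inverse_add_if_invariant:
  assumes refl: "N = distr N borel (\<lambda>w. 1 - w)" and farey: "N = distr N borel farey_map"
    and x: "0 < x" "x < 1" and "k \<ge> 1"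
  shows "cdf N (1 / (real k + x)) = (2 - cdf N x) / 2 ^ k"
proof -
  have R: "cdf N y = 1 - cdf N (1 - y)" for y
    using cdf_reflection[of y] refl by simp
  have half: "cdf N (y / (1 + y)) = cdf N y / 2" "cdf N (1 / (1 + y)) = 1 - cdf N y / 2"
    if "0 < y" "y < 1" for y
  proof -
    have "1 - 1 / (1 + y) = y / (1 + y)" using that by (simp add: field_simps)
    then have "cdf N (1 / (1 + y)) = 1 - cdf N (y / (1 + y))"
      using R[of "1 / (1 + y)"] by simp
    moreover have "cdf N y = cdf N (y / (1 + y)) + 1 - cdf N (1 / (1 + y))"
      using cdf_farey_map[OF that] farey by simp
    ultimately show "cdf N (y / (1 + y)) = cdf N y / 2" "cdf N (1 / (1 + y)) = 1 - cdf N y / 2"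
      by simp_all
  qed
  from \<open>k \<ge> 1\<close> show ?thesis
  proof (induction k rule: dec_induct)
    case base
    show ?case using half(2)[OF x] by (simp add: field_simps)
  next
    case (step k)
    let ?y = "1 / (real k + x)"
    have "?y / (1 + ?y) = 1 / (real (Suc k) + x)"
      using x by (simp add: field_simps)
    moreover have "cdf N (?y / (1 + ?y)) = cdf N ?y / 2"
      using x step(1) by (intro half) (auto simp: field_simps)
    ultimately show ?case
      using step.IH by simp
  qed
qed

lemma cdf_cfrac_if_invariant:
  assumes "N = distr N borel (\<lambda>w. 1 - w)" "N = distr N borel farey_map"
    and "\<forall>j. k j \<ge> 1"
  shows "cdf N (cfrac k) = question_mark_series k"
proof (rule question_mark_series_unique[where F = "\<lambda>k. cdf N (cfrac k)" and C = 1])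
  show "\<bar>cdf N (cfrac k)\<bar> \<le> 1" for k
    using cdf_nonneg cdf_bounded_prob by simp
next
  fix k :: "nat \<Rightarrow> nat"
  assume k: "\<forall>j. k j \<ge> 1"
  then have "cfrac (\<lambda>i. k (Suc i)) \<in> {0<..<1}"
    by (intro cfrac_in_unit_interval) simp
  then show "cdf N (cfrac k) = (2 - cdf N (cfrac (\<lambda>i. k (Suc i)))) / 2 ^ k 0"
    unfolding cfrac_rec[OF k]
    using k by (intro cdf_inverse_add_if_invariant assms) auto
qed fact

text \<open>
  Prepending 1 to the partial quotients is \<open>1/(1+x)\<close> and increasing the leading one is
  \<open>x/(1+x)\<close>, so the recursion for the series turns into the two functional equations of the
  distribution function on continued fractions.  Reflection exchanges the images of these two
  branches: \<open>1/(1+x)\<close> and \<open>x/(1+x)\<close> sum to 1, and every continued fraction is in one of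
  the two forms, according to whether its leading partial quotient is 1.
\<close>

lemma invariant_if_cdf_cfrac:
  assumes Q: "\<And>k. \<forall>j. k j \<ge> 1 \<Longrightarrow> cdf N (cfrac k) = question_mark_series k"
  shows "N = distr N borel (\<lambda>w. 1 - w)" "N = distr N borel farey_map"
proof -
  have rec: "cdf N (1 / (real m + cfrac k)) = (2 - cdf N (cfrac k)) / 2 ^ m"
    if "\<forall>j. k j \<ge> 1" "m \<ge> 1" for k m
  proof -
    \<comment> \<open>\<open>case_nat m k\<close> is the sequence \<open>k\<close> with \<open>m\<close> prepended.\<close>
    have *: "\<forall>j. case_nat m k j \<ge> 1" using that by (auto split: nat.split)
    from cfrac_rec[OF *] Q[OF *] question_mark_series_rec[OF *] Q[OF that(1)]
    show ?thesis by simp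
  qed
  have one: "cdf N (1 / (1 + cfrac k)) = 1 - cdf N (cfrac k) / 2" if "\<forall>j. k j \<ge> 1" for k
    using rec[OF that, of 1] by (simp add: field_simps)
  have half: "cdf N (cfrac k / (1 + cfrac k)) = cdf N (cfrac k) / 2" if k: "\<forall>j. k j \<ge> 1" for k
  proof -
    have k': "\<forall>j. k (Suc j) \<ge> 1" using k by simp
    have pos: "0 < cfrac (\<lambda>i. k (Suc i))"
      using cfrac_in_unit_interval[of "\<lambda>i. k (Suc i)"] k by simp
    have "cfrac k / (1 + cfrac k) = 1 / (real (Suc (k 0)) + cfrac (\<lambda>i. k (Suc i)))"
      unfolding cfrac_rec[OF k] using pos by (simp add: field_simps add_pos_pos)
    then show ?thesis
      using rec[OF k', of "Suc (k 0)"] rec[OF k', of "k 0"] k cfrac_rec[OF k] by simp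
  qed
  show "N = distr N borel farey_map"
  proof (rule real_distribution_eqI_cfrac)
    show "real_distribution N" by unfold_locales
    show "real_distribution (distr N borel farey_map)"
      by (rule real_distribution_image) simp
    fix k :: "nat \<Rightarrow> nat" assume k: "\<forall>j. k j \<ge> 1"
    then show "cdf N (cfrac k) = cdf (distr N borel farey_map) (cfrac k)"
      using cfrac_in_unit_interval[OF k] by (simp add: cdf_farey_map one half)
  qed (simp_all add: cdf_0 cdf_1 cdf_farey_map_0 cdf_farey_map_1)
  show "N = distr N borel (\<lambda>w. 1 - w)"
  proof (rule real_distribution_eqI_cfrac)
    show "real_distribution N" by unfold_locales
    show "real_distribution (distr N borel (\<lambda>w. 1 - w))"
      by (rule real_distribution_image) simp
    fix k :: "nat \<Rightarrow> nat" assume k: "\<forall>j. k j \<ge> 1"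
    let ?k' = "\<lambda>i. k (Suc i)"
    have k': "\<forall>j. ?k' j \<ge> 1" using k by simp
    have "cdf N (1 - cfrac k) = 1 - cdf N (cfrac k)"
    proof (cases "k 0 = 1")
      case True
      let ?x = "cfrac ?k'"
      have x: "0 < ?x" using cfrac_in_unit_interval[OF k'] by simp
      have "cfrac k = 1 / (1 + ?x)" using cfrac_rec[OF k] True by simp
      moreover from this have "1 - cfrac k = ?x / (1 + ?x)" using x by (simp add: field_simps)
      ultimately show ?thesis using one[OF k'] half[OF k'] by simp
    next
      case False
      \<comment> \<open>Undo the branch \<open>x/(1+x)\<close> by decreasing the leading partial quotient.\<close>
      define l where "l = case_nat (k 0 - 1) ?k'"
      have "1 \<le> k 0" using k by simp
      with False have "1 \<le> k 0 - 1" by linarith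
      then have l: "\<forall>j. l j \<ge> 1" using k by (auto simp: l_def split: nat.split)
      let ?x = "cfrac l"
      have x: "0 < ?x" using cfrac_in_unit_interval[OF l] unfolding greaterThanLessThan_iff by blast
      have y: "0 < cfrac ?k'" using cfrac_in_unit_interval[OF k'] by simp
      have "1 + real (k 0 - 1) = real (k 0)" using \<open>1 \<le> k 0\<close> by (simp add: of_nat_diff)
      moreover have "?x = 1 / (real (k 0 - 1) + cfrac ?k')"
        using cfrac_rec[OF l] by (simp add: l_def)
      ultimately have "1 / ?x = 1 / cfrac k - 1"
        using cfrac_rec[OF k] by simp
      moreover have "0 < cfrac k" using cfrac_in_unit_interval[OF k] by simp
      ultimately have "cfrac k = ?x / (1 + ?x)" using x by (simp add: field_simps)
      moreover from this have "1 - cfrac k = 1 / (1 + ?x)" using x by (simp add: field_simps)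
      ultimately show ?thesis using one[OF l] half[OF l] by simp
    qed
    then show "cdf N (cfrac k) = cdf (distr N borel (\<lambda>w. 1 - w)) (cfrac k)"
      by (simp add: cdf_reflection)
  qed (simp_all add: cdf_0 cdf_1 cdf_reflection)
qed

end

section \<open>The law of a random continued fraction\<close>

lemma real_distribution_cfrac_law: "real_distribution (cfrac_law p)"
proof -
  interpret sequence_space "measure_pmf p" by unfold_locales
  show ?thesis
    unfolding cfrac_law_def using measurable_cfrac[of p] by (rule real_distribution_distr)
qed

text \<open>
  The common form of all probabilities computed for \<open>\<mu>(p)\<close>: a random continued fraction is
  \<open>1/(s + y)\<close>, where \<open>s\<close> has law \<open>p\<close> and \<open>y\<close> is an independent random continued
  fraction.  Events that, given \<open>s\<close>, still depend on \<open>y\<close> for just one value \<open>k\<close> of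
  \<open>s\<close> have the probability of a rectangle plus that of a slice.
\<close>

lemma measure_cfrac_law_first_digit:
  assumes p: "0 \<notin> set_pmf p" and A: "A \<in> sets borel" and B: "B \<in> sets borel" and "k \<notin> T"
    and split: "\<And>s y. s \<ge> 1 \<Longrightarrow> y \<in> {0<..<1} \<Longrightarrow>
      1 / (real s + y) \<in> A \<longleftrightarrow> s \<in> T \<or> s = k \<and> y \<in> B"
  shows "measure (cfrac_law p) A = measure p T + pmf p k * measure (cfrac_law p) B"
proof -
  interpret sequence_space "measure_pmf p" by unfold_locales
  let ?P = "measure_pmf p \<Otimes>\<^sub>M S"
  let ?f = "\<lambda>(s, \<omega>). case_nat s \<omega> :: nat \<Rightarrow> nat"
  have space: "space S = UNIV" by (simp add: space_PiM)
  interpret P: pair_prob_space "measure_pmf p" S ..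
  have f: "?f \<in> measurable ?P S"
    unfolding split_beta' by measurable
  have cf: "cfrac \<in> borel_measurable S" by (rule measurable_cfrac)
  have law: "measure (cfrac_law p) C = measure S (cfrac -` C)" if "C \<in> sets borel" for C
    using that measurable_cfrac[of p] by (simp add: cfrac_law_def measure_distr space)
  have "AE \<omega> in S. \<forall>j. \<omega> j \<ge> 1"
    unfolding AE_all_countable
  proof
    fix j show "AE \<omega> in S. \<omega> j \<ge> 1"
      by (rule AE_PiM_component)
         (use p in \<open>auto simp: AE_measure_pmf_iff prob_space_measure_pmf Suc_le_eq intro!: gr0I\<close>)
  qed
  \<comment> \<open>Prepending an independent coordinate to the i.i.d. sequence does not change its law.\<close>
  then have "AE \<omega> in distr ?P S ?f. \<forall>j. \<omega> j \<ge> 1"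
    unfolding PiM_iter .
  then have pos: "AE z in ?P. \<forall>j. ?f z j \<ge> 1"
    by (rule AE_distrD[OF f])
  have times: "measure ?P (X \<times> Y) = measure p X * measure S Y"
    if "X \<in> sets (measure_pmf p)" "Y \<in> sets S" for X Y
    unfolding measure_def emeasure_pair_measure_Times[OF that] by (rule enn2real_mult)
  have A': "cfrac -` A \<in> sets S" and B': "cfrac -` B \<in> sets S"
    using measurable_sets[OF cf A] measurable_sets[OF cf B] by (simp_all add: space)
  have "measure (cfrac_law p) A = measure (distr ?P S ?f) (cfrac -` A)"
    unfolding PiM_iter by (rule law[OF A])
  also have "\<dots> = measure ?P (?f -` (cfrac -` A) \<inter> space ?P)"
    by (rule measure_distr[OF f A'])
  also have "\<dots> = measure ?P (T \<times> UNIV \<union> {k} \<times> cfrac -` B)"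
  proof (rule measure_eq_AE)
    show "AE z in ?P. z \<in> ?f -` (cfrac -` A) \<inter> space ?P \<longleftrightarrow> z \<in> T \<times> UNIV \<union> {k} \<times> cfrac -` B"
      using pos
    proof eventually_elim
      case (elim z)
      obtain s \<omega> where z: "z = (s, \<omega>)" by fastforce
      have s: "s \<ge> 1" using elim[rule_format, of 0] z by simp
      have \<omega>: "\<forall>j. \<omega> j \<ge> 1"
      proof
        fix j show "\<omega> j \<ge> 1" using elim[rule_format, of "Suc j"] z by simp
      qed
      have "cfrac (case_nat s \<omega>) = 1 / (real s + cfrac \<omega>)"
        using cfrac_rec[of "case_nat s \<omega>"] s \<omega> by (auto split: nat.split)
      then show ?case
        using split[OF s cfrac_in_unit_interval[OF \<omega>]] z by (auto simp: space_pair_measure space)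
    qed
    show "?f -` (cfrac -` A) \<inter> space ?P \<in> sets ?P"
      by (rule measurable_sets[OF f A'])
    show "T \<times> UNIV \<union> {k} \<times> cfrac -` B \<in> sets ?P"
      using B' space by (intro sets.Un pair_measureI) (auto intro: sets.top[of S, unfolded space])
  qed
  also have "\<dots> = measure ?P (T \<times> UNIV) + measure ?P ({k} \<times> cfrac -` B)"
    using B' space \<open>k \<notin> T\<close>
    by (intro P.finite_measure_Union pair_measureI) (auto intro: sets.top[of S, unfolded space])
  also have "measure ?P (T \<times> UNIV) = measure p T * measure S UNIV"
    using sets.top[of S, unfolded space] by (intro times) auto
  also have "measure S UNIV = 1"
    using prob_space.prob_space[OF prob_space_PiM, of "UNIV :: nat set" "\<lambda>_. measure_pmf p"] space
    by (simp add: prob_space_measure_pmf)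
  also have "measure ?P ({k} \<times> cfrac -` B) = measure p {k} * measure S (cfrac -` B)"
    using B' by (intro times) auto
  finally show ?thesis
    by (simp add: law[OF B] pmf.rep_eq)
qed

lemma measure_halving_pmf_greaterThan: "measure halving_pmf {k<..} = 1 / 2 ^ k"
proof (induction k)
  case 0
  have "set_pmf halving_pmf \<subseteq> {0<..}" by (auto simp: halving_pmf_def)
  then show ?case
    by (simp add: measure_pmf.prob_eq_1 AE_measure_pmf_iff subset_eq)
next
  case (Suc k)
  have "{k<..} = {Suc k} \<union> {Suc k<..}" by auto
  then have "measure halving_pmf {k<..} = measure halving_pmf {Suc k} + measure halving_pmf {Suc k<..}"
    by (subst measure_pmf.finite_measure_Union[symmetric]) simp_all
  then show ?case
    using Suc by (simp add: measure_pmf_single pmf_halving_pmf field_simps)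
qed

lemma zero_notin_set_halving_pmf: "0 \<notin> set_pmf halving_pmf"
  by (simp add: halving_pmf_def)

lemma inverse_add_less_iff:
  fixes x y :: real
  assumes "x \<in> {0<..<1}" "y \<in> {0<..<1}"
  shows "1 / (real s + y) < 1 / (real k + x) \<longleftrightarrow> k < s \<or> s = k \<and> x < y"
    and "1 / (real s + y) = 1 / (real k + x) \<longleftrightarrow> s = k \<and> y = x"
proof -
  have pos: "0 < real s + y" "0 < real k + x" using assms by (auto intro: add_nonneg_pos)
  then have less: "1 / (real s + y) < 1 / (real k + x) \<longleftrightarrow> real k + x < real s + y"
    and eq: "1 / (real s + y) = 1 / (real k + x) \<longleftrightarrow> real k + x = real s + y"
    by (auto simp: field_simps)
  \<comment> \<open>Different integers differ by at least 1, which \<open>x\<close> and \<open>y\<close> cannot compensate.\<close>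
  consider "real s + 1 \<le> real k" | "s = k" | "real k + 1 \<le> real s"
    by linarith
  then have "(1 / (real s + y) < 1 / (real k + x) \<longleftrightarrow> k < s \<or> s = k \<and> x < y) \<and>
      (1 / (real s + y) = 1 / (real k + x) \<longleftrightarrow> s = k \<and> y = x)"
    unfolding less eq using assms by cases auto
  then show "1 / (real s + y) < 1 / (real k + x) \<longleftrightarrow> k < s \<or> s = k \<and> x < y"
    and "1 / (real s + y) = 1 / (real k + x) \<longleftrightarrow> s = k \<and> y = x"
    by blast+
qed

text \<open>
  An atom at \<open>[k\<^sub>1, k\<^sub>2, \<dots>]\<close> has mass \<open>2^{-k\<^sub>1}\<close> times that of an atom at
  \<open>[k\<^sub>2, k\<^sub>3, \<dots>]\<close>, so iterating pushes its mass below every power of 1/2.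
\<close>

lemma cfrac_law_no_atom:
  assumes "\<forall>j. k j \<ge> 1"
  shows "measure (cfrac_law halving_pmf) {cfrac k} = 0"
proof -
  interpret L: real_distribution "cfrac_law halving_pmf" by (rule real_distribution_cfrac_law)
  have *: "measure (cfrac_law halving_pmf) {cfrac k} \<le> (1 / 2) ^ n" if "\<forall>j. k j \<ge> 1" for k n
    using that
  proof (induction n arbitrary: k)
    case (Suc n)
    let ?x = "cfrac (\<lambda>i. k (Suc i))"
    have x: "?x \<in> {0<..<1}" using Suc.prems by (intro cfrac_in_unit_interval) simp
    have "measure (cfrac_law halving_pmf) {cfrac k} =
        measure halving_pmf {} + pmf halving_pmf (k 0) * measure (cfrac_law halving_pmf) {?x}"
      unfolding cfrac_rec[OF Suc.prems] using inverse_add_less_iff(2)[OF x]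
      by (intro measure_cfrac_law_first_digit zero_notin_set_halving_pmf) auto
    also have "\<dots> \<le> 1 / 2 * (1 / 2) ^ n"
    proof -
      have "1 \<le> k 0" using Suc.prems by simp
      then have "pmf halving_pmf (k 0) \<le> 1 / 2"
        using power_increasing[of 1 "k 0" "2::real"] by (simp add: pmf_halving_pmf field_simps)
      moreover have "measure (cfrac_law halving_pmf) {?x} \<le> (1 / 2) ^ n"
        using Suc.prems by (intro Suc.IH) simp
      ultimately have "pmf halving_pmf (k 0) * measure (cfrac_law halving_pmf) {?x}
          \<le> 1 / 2 * (1 / 2) ^ n"
        by (rule mult_mono) auto
      then show ?thesis by simp
    qed
    finally show ?case by simp
  qed (simp add: L.prob_le_1)
  have "measure (cfrac_law halving_pmf) {cfrac k} \<le> 0"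
    by (rule LIMSEQ_le_const[of "\<lambda>n. (1 / 2) ^ n"])
       (use *[OF assms] in \<open>auto intro: LIMSEQ_realpow_zero\<close>)
  then show ?thesis
    by (simp add: measure_le_0_iff)
qed

lemma cdf_cfrac_law:
  assumes "\<forall>j. k j \<ge> 1"
  shows "cdf (cfrac_law halving_pmf) (cfrac k) = question_mark_series k"
proof -
  interpret L: real_distribution "cfrac_law halving_pmf" by (rule real_distribution_cfrac_law)
  show ?thesis
  proof (rule question_mark_series_unique[where C = 1
          and F = "\<lambda>k. cdf (cfrac_law halving_pmf) (cfrac k)"])
    show "\<bar>cdf (cfrac_law halving_pmf) (cfrac k)\<bar> \<le> 1" for k
      using L.cdf_nonneg L.cdf_bounded_prob by simp
  next
    fix k :: "nat \<Rightarrow> nat"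
    assume k: "\<forall>j. k j \<ge> 1"
    let ?x = "cfrac (\<lambda>i. k (Suc i))"
    have x: "?x \<in> {0<..<1}" using k by (intro cfrac_in_unit_interval) simp
    have "cdf (cfrac_law halving_pmf) (cfrac k) = L.prob ({..<cfrac k} \<union> {cfrac k})"
      unfolding cdf_def by (rule arg_cong[where f = L.prob]) auto
    also have "\<dots> = L.prob {..<cfrac k}"
      by (subst L.finite_measure_Union) (auto simp: cfrac_law_no_atom[OF k])
    also have "\<dots> = measure halving_pmf {k 0<..} + pmf halving_pmf (k 0) * L.prob {?x<..}"
      unfolding cfrac_rec[OF k] using inverse_add_less_iff(1)[OF x]
      by (intro measure_cfrac_law_first_digit zero_notin_set_halving_pmf) auto
    also have "L.prob {?x<..} = L.prob (space (cfrac_law halving_pmf) - {..?x})"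
      by (rule arg_cong[where f = L.prob]) auto
    also have "\<dots> = 1 - cdf (cfrac_law halving_pmf) ?x"
      unfolding cdf_def by (rule L.prob_compl) auto
    also have "pmf halving_pmf (k 0) = 1 / 2 ^ k 0"
      using k by (auto simp: pmf_halving_pmf Suc_le_eq)
    finally show "cdf (cfrac_law halving_pmf) (cfrac k) =
        (2 - cdf (cfrac_law halving_pmf) ?x) / 2 ^ k 0"
      by (simp add: measure_halving_pmf_greaterThan field_simps)
  qed fact
qed

lemma cdf_cfrac_law_0_1:
  "cdf (cfrac_law halving_pmf) 0 = 0" "cdf (cfrac_law halving_pmf) 1 = 1"
proof -
  have "cdf (cfrac_law halving_pmf) 0 =
      measure halving_pmf {} + pmf halving_pmf 0 * measure (cfrac_law halving_pmf) {}"
    unfolding cdf_def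
    by (intro measure_cfrac_law_first_digit zero_notin_set_halving_pmf)
       (auto simp: divide_le_0_iff)
  then show "cdf (cfrac_law halving_pmf) 0 = 0" by simp
  have "cdf (cfrac_law halving_pmf) 1 =
      measure halving_pmf {0<..} + pmf halving_pmf 0 * measure (cfrac_law halving_pmf) {}"
    unfolding cdf_def
    by (intro measure_cfrac_law_first_digit zero_notin_set_halving_pmf) auto
  then show "cdf (cfrac_law halving_pmf) 1 = 1"
    by (simp add: measure_halving_pmf_greaterThan)
qed

theorem theorem3p1:
  fixes M :: "'a measure" and W :: "'a \<Rightarrow> real"
  assumes "prob_space M"
    and "W \<in> borel_measurable M"
    and "AE \<omega> in M. W \<omega> \<in> {0..1}"
    and "\<And>x. measure (distr M borel W) {x} = 0"
  shows
    "((distr M borel W = distr M borel (\<lambda>\<omega>. 1 - W \<omega>) \<and>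
       distr M borel W = distr M borel (\<lambda>\<omega>. min (W \<omega> / (1 - W \<omega>)) ((1 - W \<omega>) / W \<omega>)))
      \<longleftrightarrow> distr M borel W = cfrac_law halving_pmf)
     \<and>
     (distr M borel W = cfrac_law halving_pmf
      \<longleftrightarrow> (\<forall>k :: nat \<Rightarrow> nat. (\<forall>j. k j \<ge> 1) \<longrightarrow>
            \<P>(\<omega> in M. W \<omega> < cfrac k) = 2 * (\<Sum>n. (- 1) ^ n / 2 ^ (\<Sum>j\<le>n. k j))))"
proof -
  interpret M: prob_space M by fact
  note [measurable] = assms(2)
  define N where "N = distr M borel W"
  interpret N: atomless_unit_law N
  proof (intro atomless_unit_law.intro atomless_unit_law_axioms.intro)
    show "real_distribution N"
      unfolding N_def by (rule M.real_distribution_distr) fact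
    show "AE x in N. x \<in> {0..1}"
      unfolding N_def using assms(3) by (subst AE_distr_iff) auto
    show "measure N {x} = 0" for x
      unfolding N_def by fact
  qed
  have reflection: "distr M borel (\<lambda>\<omega>. 1 - W \<omega>) = distr N borel (\<lambda>w. 1 - w)"
    unfolding N_def by (subst distr_distr) (auto simp: comp_def)
  have farey: "distr M borel (\<lambda>\<omega>. min (W \<omega> / (1 - W \<omega>)) ((1 - W \<omega>) / W \<omega>)) = distr N borel farey_map"
    unfolding N_def by (subst distr_distr) (auto simp: comp_def farey_map_def)
  have cdf: "\<P>(\<omega> in M. W \<omega> < x) = cdf N x" for x
  proof -
    have "\<P>(\<omega> in M. W \<omega> < x) = measure N {..<x}"
      unfolding N_def by (subst measure_distr) (auto intro!: arg_cong[where f = "measure M"])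
    then show ?thesis by (simp add: N.prob_lessThan)
  qed
  let ?Q = "\<forall>k. (\<forall>j. k j \<ge> 1) \<longrightarrow> cdf N (cfrac k) = question_mark_series k"
  have "(N = distr N borel (\<lambda>w. 1 - w) \<and> N = distr N borel farey_map) \<longleftrightarrow> ?Q"
    using N.cdf_cfrac_if_invariant N.invariant_if_cdf_cfrac by blast
  moreover have "N = cfrac_law halving_pmf \<longleftrightarrow> ?Q"
  proof
    assume "N = cfrac_law halving_pmf"
    then show ?Q using cdf_cfrac_law by simp
  next
    assume ?Q
    then show "N = cfrac_law halving_pmf"
      by (intro real_distribution_eqI_cfrac real_distribution_cfrac_law N.real_distribution_axioms)
         (simp_all add: N.cdf_0 N.cdf_1 cdf_cfrac_law_0_1 cdf_cfrac_law N.real_distribution_axioms)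
  qed
  ultimately show ?thesis
    unfolding N_def[symmetric] reflection farey cdf question_mark_series_def[symmetric] by blast
qed

end
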